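(* Let $D\geq 2$ be an integer. Every $(D,\mathrm{F})$-critical simple graph $G$ with $|V(G)|\geq 3$ satisfies $|E(G)|\geq \frac{(6D+5)|V(G)|+3}{3(D+1)}$.
   Context: A $(D,\mathrm{F})$-coloring of a graph $G$ is a partition $(M,F)$ of $V(G)$ such that $G[M]$ is a forest with maximum degree at most $D$ and $G[F]$ is a forest. A graph is $(D,\mathrm{F})$-critical if it has no $(D,\mathrm{F})$-coloring but every proper subgraph of it has one. *)

theory Defs
  imports Complex_Main
begin

record 'a graph =
  verts :: "'a set"
  edges :: "'a set set"

definition simple_graph :: "'a graph \<Rightarrow> bool" where
  "simple_graph G \<longleftrightarrow> finite (verts G) \<and>
     edges G \<subseteq> {{u, v} |u v. u \<in> verts G \<and> v \<in> verts G \<and> u \<noteq> v}"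

definition subgraph :: "'a graph \<Rightarrow> 'a graph \<Rightarrow> bool" where
  "subgraph H G \<longleftrightarrow> simple_graph H \<and> verts H \<subseteq> verts G \<and> edges H \<subseteq> edges G"

definition proper_subgraph :: "'a graph \<Rightarrow> 'a graph \<Rightarrow> bool" where
  "proper_subgraph H G \<longleftrightarrow> subgraph H G \<and> H \<noteq> G"

definition induced_subgraph :: "'a graph \<Rightarrow> 'a set \<Rightarrow> 'a graph" where
  "induced_subgraph G S = \<lparr>verts = S, edges = {e \<in> edges G. e \<subseteq> S}\<rparr>"

definition degree :: "'a graph \<Rightarrow> 'a \<Rightarrow> nat" where
  "degree G v = card {e \<in> edges G. v \<in> e}"

text \<open>A cycle is given by the list of its vertices in cyclic order; the first vertex is not
  repeated at the end.\<close>

definition is_cycle :: "'a graph \<Rightarrow> 'a list \<Rightarrow> bool" where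
  "is_cycle G c \<longleftrightarrow> length c \<ge> 3 \<and> distinct c \<and> set c \<subseteq> verts G \<and>
     (\<forall>i < length c. {c ! i, c ! (Suc i mod length c)} \<in> edges G)"

definition forest :: "'a graph \<Rightarrow> bool" where
  "forest G \<longleftrightarrow> (\<nexists>c. is_cycle G c)"

text \<open>Either part of the partition may be empty.\<close>

definition DF_coloring :: "nat \<Rightarrow> 'a graph \<Rightarrow> 'a set \<Rightarrow> 'a set \<Rightarrow> bool" where
  "DF_coloring D G M F \<longleftrightarrow> M \<union> F = verts G \<and> M \<inter> F = {} \<and>
     forest (induced_subgraph G M) \<and> (\<forall>v \<in> M. degree (induced_subgraph G M) v \<le> D) \<and>
     forest (induced_subgraph G F)"

definition DF_colorable :: "nat \<Rightarrow> 'a graph \<Rightarrow> bool" where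
  "DF_colorable D G \<longleftrightarrow> (\<exists>M F. DF_coloring D G M F)"

definition DF_critical :: "nat \<Rightarrow> 'a graph \<Rightarrow> bool" where
  "DF_critical D G \<longleftrightarrow> \<not> DF_colorable D G \<and> (\<forall>H. proper_subgraph H G \<longrightarrow> DF_colorable D H)"

end

(* Allow every vertex v its own capacity k v <= D + 1, the number of neighbours in M being required
   to be less than k v, and give a vertex set T the potential
     sum over v in T of (3D + 2 + 3 k v), minus 3 (D + 1) |E(T)|.
   For k = D + 1 the theorem says that a critical graph has potential at most -3; this is shown for
   all vertex-critical instances by induction on the number of vertices. Let V be an instance of
   potential at least -2.

   Every nonempty proper subset has potential at least 4: take S of least potential and suppose that
   it is at most 3. Every outside vertex has at most one neighbour in S, since adding it would lower
   the potential. Colour S, contract its F-part to one vertex of capacity 0 (potential 3D + 2), and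
   give capacity 0 to the outside neighbours of its M-part. Capacity is cheap enough for the
   induction hypothesis to colour the smaller instance, provided S has nonpositive potential;
   potentials 1, 2, 3 leave room to lower the capacity of one boundary vertex of S by one first, and
   then one edge leaving S costs less than its full price.

   Hence all neighbours of a deleted vertex of degree 3 can have their capacity lowered by one, and
   the colouring extends back unless the deleted vertex had capacity at most 1. Giving every vertex
   half of the cost of its edges, each vertex has charge at most -1, so V has potential at
   most -|V|. *)

theory Submission
  imports Defs
begin

section \<open>Neighbourhoods and edge counts\<close>

definition nbs :: "'a set set \<Rightarrow> 'a set \<Rightarrow> 'a \<Rightarrow> 'a set" where
  "nbs E X v = {u \<in> X. {u, v} \<in> E}"

definition ecount :: "'a set set \<Rightarrow> 'a set \<Rightarrow> nat" where
  "ecount E X = card {e \<in> E. e \<subseteq> X}"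

definition two_sets :: "'a set set \<Rightarrow> bool" where
  "two_sets E \<longleftrightarrow> (\<forall>e\<in>E. card e = 2)"

lemma finite_nbs [simp]: "finite X \<Longrightarrow> finite (nbs E X v)"
  by (simp add: nbs_def)

lemma nbs_Un: "nbs E (A \<union> B) v = nbs E A v \<union> nbs E B v"
  by (auto simp: nbs_def)

lemma nbs_empty [simp]: "nbs E {} v = {}"
  by (simp add: nbs_def)

lemma card_nbs_Un:
  assumes "finite A" "finite B" "A \<inter> B = {}"
  shows "card (nbs E (A \<union> B) v) = card (nbs E A v) + card (nbs E B v)"
  unfolding nbs_Un using assms by (intro card_Un_disjoint) (auto simp: nbs_def)

lemma nbs_mono: "A \<subseteq> B \<Longrightarrow> nbs E A v \<subseteq> nbs E B v"
  by (auto simp: nbs_def)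

lemma card_nbs_mono: "finite B \<Longrightarrow> A \<subseteq> B \<Longrightarrow> card (nbs E A v) \<le> card (nbs E B v)"
  by (intro card_mono nbs_mono) auto

lemma finite_inner_edges [simp]: "finite X \<Longrightarrow> finite {e \<in> E. e \<subseteq> X}"
  by (rule finite_subset[of _ "Pow X"]) auto

lemma ecount_insert:
  assumes "two_sets E" "finite X" "v \<notin> X"
  shows "ecount E (insert v X) = ecount E X + card (nbs E X v)"
proof -
  let ?g = "\<lambda>u. {u, v}"
  have eq: "{e \<in> E. e \<subseteq> insert v X} = {e \<in> E. e \<subseteq> X} \<union> ?g ` nbs E X v"
  proof (intro equalityI subsetI)
    fix e assume e: "e \<in> {e \<in> E. e \<subseteq> insert v X}"
    show "e \<in> {e \<in> E. e \<subseteq> X} \<union> ?g ` nbs E X v"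
    proof (cases "v \<in> e")
      case True
      obtain a b where ab: "e = {a, b}" "a \<noteq> b"
        using e assms(1) by (auto simp: two_sets_def card_2_iff)
      obtain u where "e = {u, v}" "u \<noteq> v"
        using ab True by (metis doubleton_eq_iff insertE singletonD)
      then have "u \<in> nbs E X v" "e = ?g u" using e by (auto simp: nbs_def)
      then show ?thesis by blast
    qed (use e in auto)
  qed (auto simp: nbs_def)
  have inj: "inj_on ?g (nbs E X v)"
    using assms(3) by (auto simp: inj_on_def doubleton_eq_iff)
  have "ecount E (insert v X) = card {e \<in> E. e \<subseteq> X} + card (?g ` nbs E X v)"
    unfolding ecount_def eq
    by (rule card_Un_disjoint) (use assms in auto)
  then show ?thesis
    by (simp add: ecount_def card_image[OF inj])
qed

lemma ecount_empty [simp]: "two_sets E \<Longrightarrow> ecount E {} = 0"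
  by (auto simp: ecount_def two_sets_def)

lemma ecount_Un:
  assumes "two_sets E" "finite A" "finite B" "A \<inter> B = {}"
  shows "ecount E (A \<union> B) = ecount E A + ecount E B + (\<Sum>v\<in>B. card (nbs E A v))"
  using assms(3,4)
proof (induction B)
  case empty
  then show ?case using assms(1) by simp
next
  case (insert v B)
  have "ecount E (A \<union> insert v B) = ecount E (A \<union> B) + card (nbs E (A \<union> B) v)"
    using ecount_insert[of E "A \<union> B" v] insert assms by simp
  moreover have "card (nbs E (A \<union> B) v) = card (nbs E A v) + card (nbs E B v)"
    using insert assms(2) by (intro card_nbs_Un) auto
  ultimately show ?case
    using insert ecount_insert[OF assms(1), of B v] by simp
qed

text \<open>Handshake lemma. Adding \<open>x\<close> raises both sides by twice the degree of
  \<open>x\<close>: once at \<open>x\<close> itself and once spread over its neighbours.\<close>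

lemma sum_card_nbs:
  assumes "two_sets E" "finite V"
  shows "(\<Sum>v\<in>V. card (nbs E V v)) = 2 * ecount E V"
  using assms(2)
proof (induction V)
  case empty
  then show ?case using assms(1) by simp
next
  case (insert x V)
  have self: "nbs E {x} x = {}"
    using assms(1) by (auto simp: nbs_def two_sets_def)
  have split: "card (nbs E (insert x V) v) = card (nbs E {x} v) + card (nbs E V v)" for v
    using card_nbs_Un[of "{x}" V E v] insert by simp
  have "(\<Sum>v\<in>V. card (nbs E {x} v)) = (\<Sum>v\<in>V. if {x, v} \<in> E then 1 else 0)"
  proof (rule sum.cong)
    fix v
    have "nbs E {x} v = (if {x, v} \<in> E then {x} else {})" by (auto simp: nbs_def)
    then show "card (nbs E {x} v) = (if {x, v} \<in> E then 1 else 0)" by simp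
  qed simp
  also have "\<dots> = card (V \<inter> {v. {x, v} \<in> E})"
    using insert by (simp add: sum.If_cases)
  also have "V \<inter> {v. {x, v} \<in> E} = nbs E V x"
    by (auto simp: nbs_def insert_commute)
  finally have "(\<Sum>v\<in>V. card (nbs E {x} v)) = card (nbs E V x)" .
  then show ?case
    using insert ecount_insert[OF assms(1), of V x] by (simp add: split self sum.distrib)
qed

section \<open>Acyclicity as an edge count\<close>

text \<open>For finite sets this is acyclicity; counting edges makes gluing arguments additive.\<close>

definition acyc :: "'a set set \<Rightarrow> 'a set \<Rightarrow> bool" where
  "acyc E X \<longleftrightarrow> (\<forall>Y \<subseteq> X. Y \<noteq> {} \<longrightarrow> ecount E Y < card Y)"

lemma acyc_empty [simp]: "acyc E {}"
  by (simp add: acyc_def)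

text \<open>A set meeting both sides has at least two more vertices than inner edges of its two
  parts, so a single crossing edge still leaves fewer edges than vertices.\<close>

lemma acyc_Un:
  assumes "two_sets E" "finite A" "finite B" "A \<inter> B = {}" "acyc E A" "acyc E B"
    and "(\<Sum>v\<in>B. card (nbs E A v)) \<le> 1"
  shows "acyc E (A \<union> B)"
  unfolding acyc_def
proof (intro allI impI)
  fix Y assume Y: "Y \<subseteq> A \<union> B" "Y \<noteq> {}"
  let ?A = "Y \<inter> A" and ?B = "Y \<inter> B"
  have dec: "Y = ?A \<union> ?B" using Y by auto
  show "ecount E Y < card Y"
  proof (cases "?A = {} \<or> ?B = {}")
    case True
    then have "Y \<subseteq> A \<or> Y \<subseteq> B" using Y by auto
    then show ?thesis using assms(5,6) Y by (auto simp: acyc_def)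
  next
    case False
    have "(\<Sum>v\<in>?B. card (nbs E ?A v)) \<le> (\<Sum>v\<in>?B. card (nbs E A v))"
      using assms(2) by (intro sum_mono card_nbs_mono) auto
    also have "\<dots> \<le> (\<Sum>v\<in>B. card (nbs E A v))"
      using assms(3) by (intro sum_mono2) auto
    finally have cross: "(\<Sum>v\<in>?B. card (nbs E ?A v)) \<le> 1" using assms(7) by simp
    have "ecount E Y = ecount E ?A + ecount E ?B + (\<Sum>v\<in>?B. card (nbs E ?A v))"
      using ecount_Un[of E ?A ?B] assms dec by auto
    moreover have "card Y = card ?A + card ?B"
      using card_Un_disjoint[of ?A ?B] assms dec by auto
    moreover have "ecount E ?A < card ?A" "ecount E ?B < card ?B"
      using assms(5,6) False by (auto simp: acyc_def)
    ultimately show ?thesis using cross by linarith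
  qed
qed

lemma acyc_insert:
  assumes "two_sets E" "finite X" "v \<notin> X" "acyc E X" "card (nbs E X v) \<le> 1"
  shows "acyc E (insert v X)"
proof -
  have "ecount E {v} = 0"
    using ecount_insert[of E "{}" v] assms(1) by simp
  then have "acyc E {v}"
    by (auto simp: acyc_def subset_singleton_iff)
  then show ?thesis
    using acyc_Un[of E X "{v}"] assms by simp
qed

text \<open>The cyclically consecutive pairs are pairwise different edges, so the vertex set of a
  cycle violates \<open>acyc\<close>.\<close>

lemma cycle_ecount:
  assumes "is_cycle (induced_subgraph G X) c" "finite X"
  shows "set c \<subseteq> X \<and> set c \<noteq> {} \<and> card (set c) \<le> ecount (edges G) (set c)"
proof -
  let ?n = "length c"
  let ?g = "\<lambda>i. {c ! i, c ! (Suc i mod ?n)}"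
  have c: "?n \<ge> 3" "distinct c" "set c \<subseteq> X"
    using assms(1) by (simp_all add: is_cycle_def induced_subgraph_def)
  have edge: "?g i \<in> edges G" if "i < ?n" for i
    using assms(1) that by (simp add: is_cycle_def induced_subgraph_def)
  have "?n > 0" using c by linarith
  then have lt: "Suc i mod ?n < ?n" for i by simp
  have "inj_on ?g {..<?n}"
  proof (rule inj_onI)
    fix i j assume ij: "i \<in> {..<?n}" "j \<in> {..<?n}" "?g i = ?g j"
    show "i = j"
    \<comment> \<open>Equal pairs at different indices would make each index the cyclic successor of
      the other, which is impossible when the length is at least 3.\<close>
    proof (rule ccontr)
      assume "i \<noteq> j"
      then have "c ! i \<noteq> c ! j" using c ij by (simp add: nth_eq_iff_index_eq)
      then have "c ! i = c ! (Suc j mod ?n)" "c ! j = c ! (Suc i mod ?n)"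
        using ij(3) by (auto simp: doubleton_eq_iff)
      then have "i = Suc j mod ?n" "j = Suc i mod ?n"
        using c ij lt by (simp_all add: nth_eq_iff_index_eq)
      moreover have "Suc m mod ?n = (if Suc m = ?n then 0 else Suc m)" if "m < ?n" for m
        using that by auto
      ultimately show False using c(1) ij(1,2) by (auto split: if_splits)
    qed
  qed
  then have "?n = card (?g ` {..<?n})" by (simp add: card_image)
  also have "\<dots> \<le> card {e \<in> edges G. e \<subseteq> set c}"
  proof (rule card_mono)
    show "?g ` {..<?n} \<subseteq> {e \<in> edges G. e \<subseteq> set c}"
      using edge lt by auto
  qed simp
  finally show ?thesis
    using c by (auto simp: ecount_def distinct_card)
qed

text \<open>Longest-path argument: all neighbours of the first vertex of a longest path in
  \<open>Y\<close> lie on that path, and one of them other than the second vertex closes a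
  cycle.\<close>

lemma exists_cycle:
  assumes E: "two_sets (edges G)" and "finite Y" "Y \<noteq> {}" "Y \<subseteq> X"
    and deg: "\<And>v. v \<in> Y \<Longrightarrow> card (nbs (edges G) Y v) \<ge> 2"
  shows "\<exists>c. is_cycle (induced_subgraph G X) c"
proof -
  define P where "P p \<longleftrightarrow> p \<noteq> [] \<and> distinct p \<and> set p \<subseteq> Y \<and>
    (\<forall>i. Suc i < length p \<longrightarrow> {p ! i, p ! Suc i} \<in> edges G)" for p
  obtain y where "y \<in> Y" using assms(3) by blast
  then have "P [y]" by (simp add: P_def)
  moreover have "\<forall>p. P p \<longrightarrow> length p < Suc (card Y)"
    using assms(2) by (metis P_def card_mono distinct_card less_Suc_eq_le)
  ultimately obtain p where p: "P p" and max: "\<And>q. P q \<Longrightarrow> length q \<le> length p"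
    using ex_has_greatest_nat[of P "[y]" length "Suc (card Y)"] by blast
  let ?N = "nbs (edges G) Y (hd p)"
  have hd: "hd p = p ! 0" "hd p \<in> Y" using p by (auto simp: P_def hd_conv_nth)
  have N: "?N \<subseteq> set p"
  proof
    fix u assume u: "u \<in> ?N"
    show "u \<in> set p"
    proof (rule ccontr)
      assume "u \<notin> set p"
      then have "P (u # p)"
        using p u hd by (auto simp: P_def nbs_def nth_Cons split: nat.splits)
      then show False using max by fastforce
    qed
  qed
  have "\<not> ?N \<subseteq> {p ! 1}"
    using deg[OF hd(2)] card_mono[of "{p ! 1}" ?N] by auto
  then obtain u where u: "u \<in> ?N" "u \<noteq> p ! 1" by blast
  then obtain j where j: "j < length p" "u = p ! j" using N by (metis in_set_conv_nth subsetD)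
  have "u \<noteq> hd p" using u(1) E by (auto simp: nbs_def two_sets_def)
  \<comment> \<open>The neighbour \<open>u\<close> is neither the first nor the second vertex, so
    the initial segment ending in \<open>u\<close> has at least three vertices.\<close>
  then have j2: "j \<ge> 2" using j u hd
    by (metis One_nat_def less_2_cases not_le)
  let ?c = "take (Suc j) p"
  have len: "length ?c = Suc j" using j by simp
  have "is_cycle (induced_subgraph G X) ?c"
    unfolding is_cycle_def
  proof (intro conjI allI impI)
    show "length ?c \<ge> 3" using j2 len by simp
    show "distinct ?c" using p by (simp add: P_def)
    show sub: "set ?c \<subseteq> verts (induced_subgraph G X)"
      using p assms(4) set_take_subset[of "Suc j" p] by (auto simp: P_def induced_subgraph_def)
    fix i assume i: "i < length ?c"
    have "{?c ! i, ?c ! (Suc i mod length ?c)} \<in> edges G"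
    proof (cases "i = j")
      case True
      then show ?thesis using j u(1) hd len by (simp add: nbs_def)
    next
      case False
      then have "Suc i < Suc j" using i len by simp
      then show ?thesis using p j len by (simp add: P_def)
    qed
    moreover have "Suc i mod length ?c < length ?c" using j2 len by (intro mod_less_divisor) simp
    ultimately show "{?c ! i, ?c ! (Suc i mod length ?c)} \<in> edges (induced_subgraph G X)"
      using sub nth_mem[of i ?c] nth_mem[of "Suc i mod length ?c" ?c] i
      by (auto simp: induced_subgraph_def)
  qed
  then show ?thesis by blast
qed

text \<open>From forest to \<open>acyc\<close>: every nonempty subset has a vertex of degree at most
  1, since otherwise it would contain a cycle. Deleting that vertex removes at most one edge, so
  induction on the subset applies.\<close>

lemma forest_iff_acyc:
  assumes E: "two_sets (edges G)" and X: "finite X"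
  shows "forest (induced_subgraph G X) \<longleftrightarrow> acyc (edges G) X"
proof
  assume "acyc (edges G) X"
  then show "forest (induced_subgraph G X)"
    using cycle_ecount[OF _ X] unfolding forest_def acyc_def by (meson leD)
next
  assume forest: "forest (induced_subgraph G X)"
  have "ecount (edges G) Y < card Y" if "Y \<subseteq> X" "Y \<noteq> {}" for Y
    using finite_subset[OF that(1) X] that
  proof (induction Y rule: finite_psubset_induct)
    case (psubset Y)
    obtain v where v: "v \<in> Y" "card (nbs (edges G) Y v) \<le> 1"
      using exists_cycle[OF E psubset(1,4,3)] forest
      by (force simp: forest_def not_le)
    let ?Z = "Y - {v}"
    have ins: "insert v ?Z = Y" using v by auto
    have "card (nbs (edges G) ?Z v) \<le> 1"
      using card_nbs_mono[of Y ?Z "edges G" v] psubset(1) v by auto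
    moreover have "ecount (edges G) Y = ecount (edges G) ?Z + card (nbs (edges G) ?Z v)"
      using ecount_insert[OF E, of ?Z v] ins psubset(1) by simp
    moreover have "card Y = Suc (card ?Z)"
      using ins psubset(1) by (metis Diff_iff card_insert_disjoint finite_Diff singletonI)
    moreover have "ecount (edges G) ?Z < card ?Z \<or> ?Z = {}"
      using psubset(2)[of ?Z] v psubset(3) by auto
    ultimately show ?case using ecount_empty[OF E] by fastforce
  qed
  then show "acyc (edges G) X" by (simp add: acyc_def)
qed


section \<open>Colourings with capacities, and their extension by one vertex\<close>

text \<open>A vertex v may have fewer than k v neighbours inside M, so k v = 0 forces v into F and
  k v = D + 1 is the capacity of the original problem.\<close>

definition cap_coloring :: "'a set set \<Rightarrow> 'a set \<Rightarrow> ('a \<Rightarrow> nat) \<Rightarrow> 'a set \<Rightarrow> 'a set \<Rightarrow> bool" where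
  "cap_coloring E V k M F \<longleftrightarrow> M \<union> F = V \<and> M \<inter> F = {} \<and> acyc E M \<and> acyc E F \<and>
     (\<forall>v\<in>M. card (nbs E M v) < k v)"

definition cap_colorable :: "'a set set \<Rightarrow> 'a set \<Rightarrow> ('a \<Rightarrow> nat) \<Rightarrow> bool" where
  "cap_colorable E V k \<longleftrightarrow> (\<exists>M F. cap_coloring E V k M F)"

lemma cap_colorable_empty [simp]: "cap_colorable E {} k"
  by (auto simp: cap_colorable_def cap_coloring_def)

lemma cap_coloring_mono:
  assumes "cap_coloring E V k' M F" "\<And>v. v \<in> V \<Longrightarrow> k' v \<le> k v"
  shows "cap_coloring E V k M F"
  using assms unfolding cap_coloring_def by (meson UnI1 order_less_le_trans)

lemma nbs_self: "two_sets E \<Longrightarrow> nbs E (insert v X) v = nbs E X v"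
  by (auto simp: nbs_def two_sets_def)

lemma card_nbs_insert_other:
  assumes "finite X" "v \<notin> X"
  shows "card (nbs E (insert v X) u) = card (nbs E X u) + (if {v, u} \<in> E then 1 else 0)"
proof -
  have "nbs E (insert v X) u = nbs E X u \<union> (if {v, u} \<in> E then {v} else {})"
    by (auto simp: nbs_def)
  moreover have "v \<notin> nbs E X u" using assms by (auto simp: nbs_def)
  ultimately show ?thesis using assms by simp
qed

lemma cap_colorable_insert_F:
  assumes E: "two_sets E" and fin: "finite V" and v: "v \<notin> V"
    and col: "cap_coloring E V k M F" and F: "card (nbs E F v) \<le> 1"
  shows "cap_colorable E (insert v V) k"
proof -
  have "finite F" "v \<notin> F" "v \<notin> M" using col fin v by (auto simp: cap_coloring_def)
  then have "cap_coloring E (insert v V) k M (insert v F)"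
    using col acyc_insert[OF E, of F v] F by (auto simp: cap_coloring_def)
  then show ?thesis by (auto simp: cap_colorable_def)
qed

lemma cap_colorable_insert_M:
  assumes E: "two_sets E" and fin: "finite V" and v: "v \<notin> V"
    and col: "cap_coloring E V k M F" and M: "card (nbs E M v) \<le> 1" "card (nbs E M v) < k v"
    and slack: "\<And>u. u \<in> nbs E M v \<Longrightarrow> card (nbs E M u) + 1 < k u"
  shows "cap_colorable E (insert v V) k"
proof -
  have fv: "finite M" "v \<notin> F" "v \<notin> M" using col fin v by (auto simp: cap_coloring_def)
  have "card (nbs E (insert v M) u) < k u" if u: "u \<in> insert v M" for u
  proof (cases "u = v")
    case True
    then show ?thesis using M nbs_self[OF E, of v M] by simp
  next
    case False
    then have uM: "u \<in> M" using u by simp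
    show ?thesis
    proof (cases "{v, u} \<in> E")
      case True
      then have "u \<in> nbs E M v" using uM by (simp add: nbs_def insert_commute)
      then show ?thesis using slack card_nbs_insert_other[OF fv(1,3), of E u] True by simp
    next
      case False
      then show ?thesis
        using card_nbs_insert_other[OF fv(1,3), of E u] uM col by (simp add: cap_coloring_def)
    qed
  qed
  then have "cap_coloring E (insert v V) k (insert v M) F"
    using col fv acyc_insert[OF E, of M v] M by (auto simp: cap_coloring_def)
  then show ?thesis by (auto simp: cap_colorable_def)
qed

text \<open>The vertex joins F unless it has two neighbours there. In that case it has none in M,
  and any positive capacity lets it join M.\<close>

lemma cap_colorable_insert_small:
  assumes E: "two_sets E" and fin: "finite V" and v: "v \<notin> V" and k: "k v > 0"
    and col: "cap_colorable E V k" and deg: "card (nbs E V v) \<le> 2"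
  shows "cap_colorable E (insert v V) k"
proof -
  obtain M F where MF: "cap_coloring E V k M F" using col by (auto simp: cap_colorable_def)
  have fv: "finite M" "finite F" "M \<inter> F = {}" "V = M \<union> F"
    using MF fin by (auto simp: cap_coloring_def)
  show ?thesis
  proof (cases "card (nbs E F v) \<le> 1")
    case True
    then show ?thesis using cap_colorable_insert_F[OF E fin v MF] by simp
  next
    case False
    then have "card (nbs E M v) = 0"
      using deg card_nbs_Un[OF fv(1,2,3), of E v] fv(4) by simp
    moreover from this have "nbs E M v = {}" using fv by simp
    ultimately show ?thesis using cap_colorable_insert_M[OF E fin v MF] k by simp
  qed
qed

section \<open>Contracting a coloured set and expanding again\<close>

text \<open>The set S is replaced by the single vertex f standing for its part FS; the side R then sees
  FS through f, while its neighbours in MS have lost all capacity, except possibly v0.\<close>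

definition contract :: "'a set set \<Rightarrow> 'a set \<Rightarrow> 'a set \<Rightarrow> 'a \<Rightarrow> 'a set set" where
  "contract E R FS f = {e \<in> E. e \<subseteq> R} \<union> (\<lambda>v. {f, v}) ` {v \<in> R. nbs E FS v \<noteq> {}}"

lemma contract_two_sets:
  "two_sets E \<Longrightarrow> f \<notin> R \<Longrightarrow> two_sets (contract E R FS f)"
  unfolding two_sets_def contract_def by (fastforce simp: card_2_iff)

lemma contract_ecount:
  assumes "f \<notin> R" "X \<subseteq> R"
  shows "ecount (contract E R FS f) X = ecount E X"
proof -
  have "{e \<in> contract E R FS f. e \<subseteq> X} = {e \<in> E. e \<subseteq> X}"
    using assms by (auto simp: contract_def)
  then show ?thesis by (simp add: ecount_def)
qed

lemma contract_nbs:
  assumes "f \<notin> R" "X \<subseteq> R" "v \<in> R"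
  shows "nbs (contract E R FS f) X v = nbs E X v"
  using assms by (auto simp: contract_def nbs_def doubleton_eq_iff)

text \<open>By \<open>one\<close>, no two edges from \<open>FS\<close> share their end in
  \<open>R\<close>. Contraction therefore merges no edges, and edges at \<open>f\<close> correspond
  to edges leaving \<open>FS\<close>.\<close>

lemma contract_nbs_f:
  assumes "f \<notin> R" "X \<subseteq> R" "finite X" "finite S" "FS \<subseteq> S"
    and one: "\<And>v. v \<in> R \<Longrightarrow> card (nbs E S v) \<le> 1"
  shows "card (nbs (contract E R FS f) X f) = (\<Sum>v\<in>X. card (nbs E FS v))"
proof -
  have "nbs (contract E R FS f) X f = X \<inter> {v. nbs E FS v \<noteq> {}}"
    using assms(1,2) by (auto simp: contract_def nbs_def doubleton_eq_iff)
  then have "card (nbs (contract E R FS f) X f) = (\<Sum>v\<in>X. if nbs E FS v \<noteq> {} then 1 else 0)"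
    using assms(3) by (simp add: sum.If_cases)
  also have "\<dots> = (\<Sum>v\<in>X. card (nbs E FS v))"
  proof (rule sum.cong)
    fix v assume "v \<in> X"
    then have "card (nbs E FS v) \<le> 1"
      using one[of v] assms(2) card_nbs_mono[OF assms(4,5), of E v] by auto
    moreover have "finite (nbs E FS v)" using finite_subset[OF assms(5,4)] by simp
    then have "nbs E FS v \<noteq> {} \<longleftrightarrow> card (nbs E FS v) > 0" by auto
    ultimately show "(if nbs E FS v \<noteq> {} then 1 else 0) = card (nbs E FS v)" by auto
  qed simp
  finally show ?thesis .
qed

text \<open>If \<open>Y\<close> meets \<open>FS\<close>, its part in \<open>FR\<close> together with
  \<open>f\<close> bounds the edges inside \<open>FR\<close> and those towards \<open>FS\<close>,
  while the part in \<open>FS\<close> has fewer edges than vertices by itself. Adding the two bounds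
  gives the claim.\<close>

lemma acyc_expand:
  assumes E: "two_sets E" and fin: "finite S" "finite R" "FS \<subseteq> S" and disj: "S \<inter> R = {}"
    and f: "f \<notin> R" and one: "\<And>v. v \<in> R \<Longrightarrow> card (nbs E S v) \<le> 1"
    and FR: "FR \<subseteq> R" and FS: "acyc E FS" and ac: "acyc (contract E R FS f) (insert f FR)"
  shows "acyc E (FS \<union> FR)"
  unfolding acyc_def
proof (intro allI impI)
  fix Y assume Y: "Y \<subseteq> FS \<union> FR" "Y \<noteq> {}"
  let ?E = "contract E R FS f"
  let ?S = "Y \<inter> FS" and ?R = "Y \<inter> FR"
  have dec: "Y = ?S \<union> ?R" using Y by auto
  have fin': "finite ?S" "finite ?R" "?S \<inter> ?R = {}" and R: "?R \<subseteq> R" "f \<notin> ?R"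
    using fin finite_subset[OF fin(3,1)] finite_subset[OF FR fin(2)] disj FR f by auto
  show "ecount E Y < card Y"
  proof (cases "?S = {}")
    case True
    then have YR: "Y = ?R" using dec by simp
    moreover have "?R \<subseteq> insert f FR" by auto
    ultimately have "ecount ?E Y < card Y" using Y(2) ac by (metis acyc_def)
    then show ?thesis using contract_ecount[OF f, of Y E FS] YR R by auto
  next
    case False
    then have S: "ecount E ?S < card ?S" using FS by (simp add: acyc_def)
    have "insert f ?R \<subseteq> insert f FR" by auto
    then have "ecount ?E (insert f ?R) < card (insert f ?R)"
      using ac by (auto simp: acyc_def)
    \<comment> \<open>The vertex \<open>f\<close> is dropped from the count, which turns "fewer
      than" into "at most".\<close>
    then have "ecount E ?R + (\<Sum>v\<in>?R. card (nbs E FS v)) \<le> card ?R"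
      using ecount_insert[OF contract_two_sets[OF E f] fin'(2) R(2)] fin'(2) R
        contract_ecount[OF f R(1), of E FS] contract_nbs_f[OF f R(1) fin'(2) fin(1,3) one]
      by simp
    moreover have "(\<Sum>v\<in>?R. card (nbs E ?S v)) \<le> (\<Sum>v\<in>?R. card (nbs E FS v))"
      using finite_subset[OF fin(3,1)] by (intro sum_mono card_nbs_mono) auto
    moreover have "ecount E Y = ecount E ?S + ecount E ?R + (\<Sum>v\<in>?R. card (nbs E ?S v))"
      using ecount_Un[OF E fin'] dec by simp
    moreover have "card Y = card ?S + card ?R"
      using card_Un_disjoint[OF fin'] dec by simp
    ultimately show ?thesis using S by linarith
  qed
qed

text \<open>Capacity 0 forces \<open>f\<close> into F, so the two F-parts glue as in
  \<open>acyc_expand\<close>. On the M-side only the edge between \<open>v0\<close> and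
  \<open>s0\<close> can cross, and by \<open>cross\<close> both of its ends have a spare unit of
  capacity for it.\<close>

lemma cap_colorable_expand:
  assumes E: "two_sets E" and fin: "finite S" "finite R" and disj: "S \<inter> R = {}"
    and f: "f \<in> S" and one: "\<And>v. v \<in> R \<Longrightarrow> card (nbs E S v) \<le> 1"
    and S: "cap_coloring E S k MS FS"
    and R: "cap_colorable (contract E R FS f) (insert f R) k'"
    and kf: "k' f = 0" and k': "\<And>v. v \<in> R \<Longrightarrow> k' v \<le> k v"
    and cross: "\<And>v. v \<in> R \<Longrightarrow> nbs E MS v \<noteq> {} \<Longrightarrow>
       k' v = 0 \<or> v = v0 \<and> nbs E MS v = {s0} \<and> k' v < k v \<and> card (nbs E MS s0) + 1 < k s0"
  shows "cap_colorable E (S \<union> R) k"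
proof -
  let ?E = "contract E R FS f"
  obtain M F where MF: "cap_coloring ?E (insert f R) k' M F"
    using R by (auto simp: cap_colorable_def)
  have fR: "f \<notin> R" using f disj by auto
  have "f \<notin> M" using MF kf by (auto simp: cap_coloring_def)
  then have fF: "f \<in> F" and MR: "M \<subseteq> R" using MF by (auto simp: cap_coloring_def)
  define FR where "FR = F - {f}"
  have F_eq: "F = insert f FR" and FR: "FR \<subseteq> R" and R_eq: "R = M \<union> FR" "M \<inter> FR = {}"
    using MF fF fR MR by (auto simp: cap_coloring_def FR_def)
  have S': "S = MS \<union> FS" "MS \<inter> FS = {}" "acyc E MS" "acyc E FS" "finite MS" "finite FS"
    and slackS: "\<And>v. v \<in> MS \<Longrightarrow> card (nbs E MS v) < k v"
    using S fin(1) by (auto simp: cap_coloring_def)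
  have finM: "finite M" using fin(2) MR finite_subset by blast
  have MSM: "MS \<inter> M = {}" using S' MR disj by auto
  have acF: "acyc E (FS \<union> FR)"
  proof (rule acyc_expand[OF E fin _ disj fR one FR S'(4)])
    show "acyc ?E (insert f FR)" using MF F_eq by (simp add: cap_coloring_def)
  qed (use S' in auto)
  have capM: "card (nbs E M v) < k' v" if "v \<in> M" for v
    using MF that contract_nbs[OF fR MR, of v E FS] MR by (metis cap_coloring_def subsetD)
  have acM: "acyc E M"
    unfolding acyc_def
  proof (intro allI impI)
    fix Y assume Y: "Y \<subseteq> M" "Y \<noteq> {}"
    then have "ecount ?E Y < card Y" using MF by (auto simp: cap_coloring_def acyc_def)
    then show "ecount E Y < card Y" using contract_ecount[OF fR, of Y E FS] Y MR by auto
  qed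
  \<comment> \<open>A vertex of \<open>M\<close> has positive \<open>k'\<close>, which excludes the
    first alternative of \<open>cross\<close>.\<close>
  have cr: "v = v0 \<and> nbs E MS v = {s0} \<and> k' v < k v \<and> card (nbs E MS s0) + 1 < k s0"
    if "v \<in> M" "nbs E MS v \<noteq> {}" for v
    using cross[of v] that capM[of v] MR by auto
  have "(\<Sum>v\<in>M. card (nbs E MS v)) \<le> (\<Sum>v\<in>M. if v = v0 then 1 else 0)"
    using cr by (intro sum_mono) (fastforce simp: card_gt_0_iff)
  also have "\<dots> \<le> 1" using finM by simp
  finally have acMM: "acyc E (MS \<union> M)"
    using acyc_Un[OF E S'(5) finM MSM S'(3) acM] by simp
  have "card (nbs E (MS \<union> M) v) < k v" if v: "v \<in> MS \<union> M" for v
  proof (cases "v \<in> M")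
    case True
    then have "card (nbs E M v) < k' v" "k' v \<le> k v" using capM k' MR by auto
    moreover have "card (nbs E (MS \<union> M) v) = card (nbs E MS v) + card (nbs E M v)"
      by (rule card_nbs_Un[OF S'(5) finM MSM])
    ultimately show ?thesis using cr[OF True] by (cases "nbs E MS v = {}") auto
  next
    case False
    then have vMS: "v \<in> MS" using v by simp
    have sub: "u = v0 \<and> v = s0 \<and> card (nbs E MS s0) + 1 < k s0" if "u \<in> nbs E M v" for u
    proof -
      have "u \<in> M" "v \<in> nbs E MS u" using that vMS by (auto simp: nbs_def insert_commute)
      then show ?thesis using cr[of u] by auto
    qed
    have "card (nbs E (MS \<union> M) v) = card (nbs E MS v) + card (nbs E M v)"
      by (rule card_nbs_Un[OF S'(5) finM MSM])
    moreover have "card (nbs E M v) \<le> 1"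
      using sub card_mono[of "{v0}" "nbs E M v"] by auto
    moreover have "card (nbs E MS v) + 1 < k v" if "nbs E M v \<noteq> {}"
      using sub that by blast
    ultimately show ?thesis using slackS[OF vMS] by (cases "nbs E M v = {}") auto
  qed
  then have "cap_coloring E (S \<union> R) k (MS \<union> M) (FS \<union> FR)"
    using acF acMM S' R_eq disj unfolding cap_coloring_def by auto
  then show ?thesis by (auto simp: cap_colorable_def)
qed

lemma cap_colorable_disconnected:
  assumes E: "two_sets E" and fin: "finite S" "finite R" and disj: "S \<inter> R = {}"
    and none: "\<And>v. v \<in> R \<Longrightarrow> nbs E S v = {}"
    and "cap_colorable E S k" "cap_colorable E R k"
  shows "cap_colorable E (S \<union> R) k"
proof -
  obtain MS FS MR FR where c: "cap_coloring E S k MS FS" "cap_coloring E R k MR FR"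
    using assms by (auto simp: cap_colorable_def)
  have S: "S = MS \<union> FS" "MS \<inter> FS = {}" "acyc E MS" "acyc E FS" "finite MS" "finite FS"
    and R: "R = MR \<union> FR" "MR \<inter> FR = {}" "acyc E MR" "acyc E FR" "finite MR" "finite FR"
    using c fin by (auto simp: cap_coloring_def)
  have no: "{s, r} \<notin> E" "{r, s} \<notin> E" if "s \<in> S" "r \<in> R" for s r
    using none[OF that(2)] that(1) by (auto simp: nbs_def insert_commute)
  have "(\<Sum>v\<in>MR. card (nbs E MS v)) = 0" "(\<Sum>v\<in>FR. card (nbs E FS v)) = 0"
    using none S(1) R(1) by (simp_all add: nbs_Un)
  then have "acyc E (MS \<union> MR)" "acyc E (FS \<union> FR)"
    using acyc_Un[OF E] S R disj by (metis Int_Un_distrib Int_Un_distrib2 Un_empty le0)+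
  moreover have "nbs E (MS \<union> MR) v = (if v \<in> MS then nbs E MS v else nbs E MR v)"
    if "v \<in> MS \<union> MR" for v
    using that no S(1) R(1) by (auto simp: nbs_def)
  ultimately have "cap_coloring E (S \<union> R) k (MS \<union> MR) (FS \<union> FR)"
    using c S R disj unfolding cap_coloring_def by auto
  then show ?thesis by (auto simp: cap_colorable_def)
qed


section \<open>The potential\<close>

text \<open>One unit of capacity weighs 3 and an edge costs 3(D + 1). Removing an edge thus pays
  exactly for a loss of D + 1 units of capacity.\<close>

definition pot :: "nat \<Rightarrow> 'a set set \<Rightarrow> ('a \<Rightarrow> nat) \<Rightarrow> 'a set \<Rightarrow> int" where
  "pot D E k T = (\<Sum>v\<in>T. 3 * int D + 2 + 3 * int (k v)) - 3 * (int D + 1) * int (ecount E T)"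

lemma pot_Un:
  assumes "two_sets E" "finite A" "finite B" "A \<inter> B = {}"
  shows "pot D E k (A \<union> B) =
    pot D E k A + pot D E k B - 3 * (int D + 1) * int (\<Sum>v\<in>B. card (nbs E A v))"
  unfolding pot_def ecount_Un[OF assms] sum.union_disjoint[OF assms(2-4)]
  by (simp add: algebra_simps)

lemma pot_insert:
  assumes "two_sets E" "finite X" "v \<notin> X"
  shows "pot D E k (insert v X) =
    pot D E k X + 3 * int D + 2 + 3 * int (k v) - 3 * (int D + 1) * int (card (nbs E X v))"
  unfolding pot_def ecount_insert[OF assms] sum.insert[OF assms(2,3)]
  by (simp add: algebra_simps)

lemma pot_singleton:
  assumes "two_sets E"
  shows "pot D E k {v} = 3 * int D + 2 + 3 * int (k v)"
  using pot_insert[OF assms, of "{}" v D k] assms by (simp add: pot_def)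

text \<open>The loss \<open>c\<close> is integer-valued because it may be negative at a vertex whose
  removed edges are worth more than the capacity it loses.\<close>

lemma pot_le_add:
  assumes "\<And>v. v \<in> T \<Longrightarrow> int (k v) \<le> int (k' v) + c v"
  shows "pot D E k T \<le> pot D E k' T + 3 * (\<Sum>v\<in>T. c v)"
proof -
  have "(\<Sum>v\<in>T. 3 * int D + 2 + 3 * int (k v))
      \<le> (\<Sum>v\<in>T. (3 * int D + 2 + 3 * int (k' v)) + 3 * c v)"
    using assms by (intro sum_mono) fastforce
  also have "\<dots> = (\<Sum>v\<in>T. 3 * int D + 2 + 3 * int (k' v)) + 3 * (\<Sum>v\<in>T. c v)"
    by (simp add: sum.distrib sum_distrib_left)
  finally show ?thesis by (simp add: pot_def)
qed

section \<open>Proper subsets of a counterexample have large potential\<close>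

text \<open>The assumption \<open>smaller\<close> is the induction hypothesis of
  \<open>critical_pot\<close>, restated for sets all of whose nonempty subsets have potential at
  least -2. It ranges over all edge sets and capacities because contraction changes both.\<close>

lemma pot_gap:
  fixes E :: "'a set set"
  assumes D: "D \<ge> 2" and E: "two_sets E" and fin: "finite V" and k: "\<And>v. v \<in> V \<Longrightarrow> k v \<le> D + 1"
    and smaller: "\<And>(E :: 'a set set) W k. two_sets E \<Longrightarrow> finite W \<Longrightarrow> card W < card V \<Longrightarrow>
      (\<And>v. v \<in> W \<Longrightarrow> k v \<le> D + 1) \<Longrightarrow>
      (\<And>T. T \<subseteq> W \<Longrightarrow> T \<noteq> {} \<Longrightarrow> pot D E k T \<ge> -2) \<Longrightarrow> cap_colorable E W k"
    and uncol: "\<not> cap_colorable E V k" and crit: "\<And>T. T \<subset> V \<Longrightarrow> cap_colorable E T k"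
    and potV: "pot D E k V \<ge> -2" and U: "U \<subset> V" "U \<noteq> {}"
  shows "pot D E k U \<ge> 4"
proof (rule ccontr)
  assume "\<not> pot D E k U \<ge> 4"
  then have U3: "pot D E k U \<le> 3" by simp
  have "finite {S. S \<subset> V \<and> S \<noteq> {}}"
    by (rule finite_subset[of _ "Pow V"]) (use fin in auto)
  moreover have "{S. S \<subset> V \<and> S \<noteq> {}} \<noteq> {}" using U by blast
  ultimately obtain S where "is_arg_min (pot D E k) (\<lambda>S. S \<in> {S. S \<subset> V \<and> S \<noteq> {}}) S"
    using ex_is_arg_min_if_finite by blast
  then have SV: "S \<subset> V" "S \<noteq> {}"
    and least: "\<And>T. T \<subset> V \<Longrightarrow> T \<noteq> {} \<Longrightarrow> pot D E k S \<le> pot D E k T"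
    by (simp_all add: is_arg_min_linorder)
  define p where "p = pot D E k S"
  define R where "R = V - S"
  have p3: "p \<le> 3" using least[OF U] U3 by (simp add: p_def)
  have finSR: "finite S" "finite R" using SV fin finite_subset by (auto simp: R_def)
  have SR: "S \<inter> R = {}" "V = S \<union> R" using SV by (auto simp: R_def)
  \<comment> \<open>A single vertex has potential at least 3D + 2 > 3. With two vertices in
    \<open>S\<close>, contracting it to one vertex makes the instance strictly smaller.\<close>
  have "card S \<noteq> 1"
    using p3 pot_singleton[OF E, of D k] D by (auto simp: p_def card_1_singleton_iff)
  then have card2: "card S \<ge> 2"
    using SV finSR by (metis One_nat_def card_gt_0_iff less_2_cases_iff not_le not_less0)
  have one: "card (nbs E S v) \<le> 1" if v: "v \<in> R" for v
  proof (rule ccontr)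
    assume "\<not> card (nbs E S v) \<le> 1"
    then have "int (card (nbs E S v)) \<ge> 2" by simp
    then have n: "3 * (int D + 1) * int (card (nbs E S v)) \<ge> 3 * (int D + 1) * 2"
      by (intro mult_left_mono) auto
    have vS: "v \<notin> S" "v \<in> V" using v by (auto simp: R_def)
    have pot: "pot D E k (insert v S) =
      p + 3 * int D + 2 + 3 * int (k v) - 3 * (int D + 1) * int (card (nbs E S v))"
      using pot_insert[OF E finSR(1) vS(1)] by (simp add: p_def)
    have kv: "int (k v) \<le> int D + 1" using k[OF vS(2)] by simp
    \<comment> \<open>The change is at most (6D + 5) - 6(D + 1) = -1.\<close>
    have "pot D E k (insert v S) < p" using pot n kv by (simp add: algebra_simps)
    then have V: "V = insert v S"
      using least[of "insert v S"] SV vS by (fastforce simp: p_def)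
    \<comment> \<open>By minimality of \<open>S\<close>, only \<open>V = insert v S\<close> remains.
      Three edges or capacity 0 at \<open>v\<close> would push the potential of \<open>V\<close>
      down to at most -1 - 3D < -2, so \<open>v\<close> has degree 2 and positive capacity and can
      be coloured last.\<close>
    have "card (nbs E S v) \<le> 2"
    proof (rule ccontr)
      assume "\<not> card (nbs E S v) \<le> 2"
      then have "int (card (nbs E S v)) \<ge> 3" by simp
      then have "3 * (int D + 1) * int (card (nbs E S v)) \<ge> 3 * (int D + 1) * 3"
        by (intro mult_left_mono) auto
      then show False using pot potV V p3 kv D by (simp add: algebra_simps)
    qed
    moreover have "k v > 0"
      using pot potV V p3 n D by (cases "k v") (simp_all add: algebra_simps)
    ultimately show False
      using cap_colorable_insert_small[OF E finSR(1) vS(1) _ crit[OF SV(1)]] uncol V by simp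
  qed
  have "\<not> (\<forall>v\<in>R. nbs E S v = {})"
  proof
    assume "\<forall>v\<in>R. nbs E S v = {}"
    moreover have "R \<subset> V" using SV by (auto simp: R_def)
    ultimately show False
      using cap_colorable_disconnected[OF E finSR SR(1) _ crit[OF SV(1)] crit[of R]] uncol SR(2)
      by simp
  qed
  then obtain v0 s0 where v0: "v0 \<in> R" "s0 \<in> nbs E S v0" by blast
  have s0: "s0 \<in> S" "s0 \<notin> R" using v0 SR by (auto simp: nbs_def)
  have nb0: "nbs E S v0 = {s0}"
    using one[OF v0(1)] v0(2) finSR(1)
    by (metis One_nat_def card_le_Suc0_iff_eq empty_iff finite_nbs insertI1 singletonD subsetI
        subset_antisym subset_singleton_iff)
  have "\<exists>MS FS. cap_coloring E S k MS FS \<and> (p > 0 \<longrightarrow> s0 \<in> MS \<longrightarrow> card (nbs E MS s0) + 1 < k s0)"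
  proof (cases "p > 0")
    case False
    then show ?thesis using crit[OF SV(1)] by (auto simp: cap_colorable_def)
  next
    case True
    \<comment> \<open>The change costs at most 3, so positive potentials stay at least -2. If
      \<open>k s0 = 0\<close>, truncated subtraction changes nothing, and \<open>s0\<close> cannot
      lie in M anyway.\<close>
    define k1 where "k1 = k(s0 := k s0 - 1)"
    have le: "k1 v \<le> k v" for v by (simp add: k1_def)
    have "cap_colorable E S k1"
    proof (rule smaller[OF E finSR(1)])
      show "card S < card V" using SV(1) fin by (rule psubset_card_mono[rotated])
      show "k1 v \<le> D + 1" if "v \<in> S" for v using le[of v] k[of v] that SV by auto
      fix T assume T: "T \<subseteq> S" "T \<noteq> {}"
      have finT: "finite T" using T finSR finite_subset by auto
      have "p \<le> pot D E k T" using least[of T] T SV by (auto simp: p_def)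
      also have "\<dots> \<le> pot D E k1 T + 3 * (\<Sum>v\<in>T. if v = s0 then 1 else 0)"
        by (rule pot_le_add) (auto simp: k1_def)
      also have "\<dots> \<le> pot D E k1 T + 3" using finT by simp
      finally show "pot D E k1 T \<ge> -2" using True by simp
    qed
    then obtain MS FS where c: "cap_coloring E S k1 MS FS" by (auto simp: cap_colorable_def)
    then have "card (nbs E MS s0) + 1 < k s0" if "s0 \<in> MS"
      using that by (force simp: cap_coloring_def k1_def)
    then show ?thesis using cap_coloring_mono[OF c le] by blast
  qed
  then obtain MS FS where col: "cap_coloring E S k MS FS"
    and slack: "p > 0 \<Longrightarrow> s0 \<in> MS \<Longrightarrow> card (nbs E MS s0) + 1 < k s0" by blast
  have MF: "S = MS \<union> FS" "MS \<inter> FS = {}" "finite MS" "finite FS" "FS \<subseteq> S"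
    using col finSR(1) by (auto simp: cap_coloring_def)
  have cardMF: "card (nbs E S v) = card (nbs E MS v) + card (nbs E FS v)" for v
    unfolding MF(1) by (rule card_nbs_Un[OF MF(3,4,2)])
  \<comment> \<open>Here \<open>s0\<close> serves as the contracted vertex and must land in F.
    Sparing all but one unit at \<open>v0\<close> is safe only for \<open>p > 0\<close>, when
    \<open>slack\<close> provides room at \<open>s0\<close>.\<close>
  define k' where "k' v = (if v = s0 then 0 else if nbs E MS v = {} then k v
    else if p > 0 \<and> v = v0 then k v - 1 else 0)" for v
  define E' where "E' = contract E R FS s0"
  have E': "two_sets E'" unfolding E'_def by (rule contract_two_sets[OF E s0(2)])
  \<comment> \<open>In passing from \<open>S \<union> X\<close> to \<open>X\<close>, the edges to
    \<open>MS\<close> pay for the lost capacity and \<open>g\<close> records what is left over at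
    each vertex. The edges to \<open>FS\<close> appear as a gain, to be spent again once the
    contracted vertex is added.\<close>
  have potX: "pot D E' k' X \<ge> pot D E k (S \<union> X) - p
      + 3 * (int D + 1) * int (\<Sum>v\<in>X. card (nbs E FS v)) + 3 * int (\<Sum>v\<in>X. g v)"
    if X: "X \<subseteq> R" and g: "\<And>v. v \<in> X \<Longrightarrow> int (k v) + int (g v) \<le>
      int (k' v) + (int D + 1) * int (card (nbs E MS v))" for X g
  proof -
    have finX: "finite X" using X finSR finite_subset by auto
    have "pot D E k X \<le> pot D E k' X
        + 3 * (\<Sum>v\<in>X. (int D + 1) * int (card (nbs E MS v)) - int (g v))"
      using g by (intro pot_le_add) force
    moreover have "(\<Sum>v\<in>X. (int D + 1) * int (card (nbs E MS v)) - int (g v))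
        = (int D + 1) * int (\<Sum>v\<in>X. card (nbs E MS v)) - int (\<Sum>v\<in>X. g v)"
      by (simp add: sum_subtractf sum_distrib_left)
    moreover have "pot D E' k' X = pot D E k' X"
      by (simp add: pot_def E'_def contract_ecount[OF s0(2) X])
    moreover have "pot D E k (S \<union> X) = p + pot D E k X
        - 3 * (int D + 1) * int (\<Sum>v\<in>X. card (nbs E S v))"
      unfolding p_def using X SR by (intro pot_Un[OF E finSR(1) finX]) auto
    moreover have "(\<Sum>v\<in>X. card (nbs E S v)) = (\<Sum>v\<in>X. card (nbs E MS v)) + (\<Sum>v\<in>X. card (nbs E FS v))"
      by (simp add: cardMF sum.distrib)
    ultimately show ?thesis by (simp add: algebra_simps)
  qed
  have lost: "int (k v) \<le> int (k' v) + (int D + 1) * int (card (nbs E MS v))" if "v \<in> R" for v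
  proof (cases "nbs E MS v = {}")
    case True
    then show ?thesis using that s0 by (auto simp: k'_def)
  next
    case False
    then have "int (card (nbs E MS v)) \<ge> 1"
      using MF(3) card_gt_0_iff[of "nbs E MS v"] by auto
    then have "(int D + 1) * 1 \<le> (int D + 1) * int (card (nbs E MS v))"
      by (intro mult_left_mono) auto
    also have "\<dots> \<le> int (k' v) + (int D + 1) * int (card (nbs E MS v))" by simp
    finally show ?thesis using k[of v] that SR by auto
  qed
  have potSX: "pot D E k (S \<union> X) \<ge> (if X = R then -2 else p)" if "X \<subseteq> R" for X
    using that potV SR SV least[of "S \<union> X"] by (auto simp: p_def)
  have "cap_colorable E' (insert s0 R) k'"
  proof (rule smaller[OF E'])
    have "card V = card S + card R"
      unfolding SR(2) by (rule card_Un_disjoint[OF finSR SR(1)])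
    then show "card (insert s0 R) < card V" using card2 s0 finSR by simp
    show "k' v \<le> D + 1" if "v \<in> insert s0 R" for v
      using that k[of v] SR(2) by (auto simp: k'_def)
    fix T assume T: "T \<subseteq> insert s0 R" "T \<noteq> {}"
    show "pot D E' k' T \<ge> -2"
    proof (cases "s0 \<in> T")
      case True
      define X where "X = T - {s0}"
      have X: "X \<subseteq> R" "T = insert s0 X" "s0 \<notin> X" "finite X"
        using T True finSR finite_subset[of X R] by (auto simp: X_def)
      \<comment> \<open>The edges at the contracted vertex cancel the \<open>FS\<close> term of
        \<open>potX\<close>. Its own weight 3D + 2 then outweighs the possible loss of 2 + p, at
        most 5.\<close>
      have "pot D E' k' T = pot D E' k' X + 3 * int D + 2
          - 3 * (int D + 1) * int (\<Sum>v\<in>X. card (nbs E FS v))"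
        using pot_insert[OF E' X(4,3), of D k']
          contract_nbs_f[OF s0(2) X(1,4) finSR(1) MF(5) one]
        by (simp add: X(2) E'_def k'_def)
      moreover have "pot D E' k' X \<ge> pot D E k (S \<union> X) - p
          + 3 * (int D + 1) * int (\<Sum>v\<in>X. card (nbs E FS v))"
        using potX[OF X(1), of "\<lambda>_. 0"] lost X(1) by auto
      ultimately show ?thesis using potSX[OF X(1)] p3 D by (auto split: if_splits)
    next
      case False
      then have TR: "T \<subseteq> R" using T by auto
      define w where "w = 3 * (int D + 1) * int (\<Sum>v\<in>T. card (nbs E FS v))"
      have ge: "pot D E' k' T \<ge> pot D E k (S \<union> T) - p + w"
        using potX[OF TR, of "\<lambda>_. 0"] lost TR by (auto simp: w_def)
      have w0: "w \<ge> 0"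
        unfolding w_def by (rule mult_nonneg_nonneg[OF _ of_nat_0_le_iff]) simp
      show ?thesis
      \<comment> \<open>For \<open>T \<noteq> R\<close> minimality gives at least 0, and for
        \<open>p \<le> 0\<close> the bound -2 - p is enough. In the remaining case up to 3 units
        must be recovered from the edge between \<open>s0\<close> and \<open>v0\<close>.\<close>
      proof (cases "T = R \<and> p > 0")
        case False
        then show ?thesis using ge w0 potSX[OF TR] by (auto split: if_splits)
      next
        case True
        then have T_eq: "T = R" and p: "p > 0" by auto
        show ?thesis
        proof (cases "s0 \<in> FS")
          case True
          then have "s0 \<in> nbs E FS v0" using v0 by (simp add: nbs_def)
          then have "card (nbs E FS v0) > 0" using MF(4) by (auto simp: card_gt_0_iff)
          moreover have "card (nbs E FS v0) \<le> (\<Sum>v\<in>T. card (nbs E FS v))"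
            using v0(1) T_eq finSR(2) by (intro member_le_sum) auto
          ultimately have "int (\<Sum>v\<in>T. card (nbs E FS v)) \<ge> 1" by linarith
          then have "w \<ge> 3 * (int D + 1) * 1" unfolding w_def by (intro mult_left_mono) auto
          then show ?thesis using ge potSX[OF TR] T_eq p3 D by simp
        next
          case False
          then have sM: "s0 \<in> MS" using s0 MF by auto
          have nbM: "nbs E MS v0 = {s0}"
            using nb0 sM MF(1) by (auto simp: nbs_def)
          \<comment> \<open>The edge from \<open>v0\<close> to \<open>s0\<close> is worth D + 1
            units of capacity, but \<open>v0\<close> gives up only one. The surplus 3D in potential
            exceeds 3.\<close>
          define g where "g v = (if v = v0 then D else 0)" for v
          have "int (k v) + int (g v) \<le> int (k' v) + (int D + 1) * int (card (nbs E MS v))"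
            if "v \<in> T" for v
          proof (cases "v = v0")
            case True
            moreover have "v0 \<noteq> s0" using v0(1) s0(2) by blast
            ultimately have "k' v = k v - 1" "card (nbs E MS v) = 1" "g v = D"
              using nbM p by (simp_all add: k'_def g_def)
            then show ?thesis by simp
          next
            case False
            then show ?thesis using lost[of v] that TR by (auto simp: g_def)
          qed
          then have "pot D E' k' T \<ge> pot D E k (S \<union> T) - p + w + 3 * int (\<Sum>v\<in>T. g v)"
            unfolding w_def by (rule potX[OF TR])
          moreover have "(\<Sum>v\<in>T. g v) = D"
            using v0(1) T_eq finSR(2) by (simp add: g_def)
          ultimately have "pot D E' k' T \<ge> pot D E k (S \<union> T) - p + w + 3 * int D"
            by (simp only:)
          then show ?thesis using w0 potSX[OF TR] T_eq p3 D by simp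
        qed
      qed
    qed
  qed (use finSR in simp)
  then have small: "cap_colorable (contract E R FS s0) (insert s0 R) k'" by (simp add: E'_def)
  have "cap_colorable E (S \<union> R) k"
  proof (rule cap_colorable_expand[OF E finSR SR(1) s0(1) one col small])
    show "k' s0 = 0" by (simp add: k'_def)
    show "k' v \<le> k v" if "v \<in> R" for v using that s0 by (auto simp: k'_def)
    fix v assume v: "v \<in> R" "nbs E MS v \<noteq> {}"
    show "k' v = 0 \<or> v = v0 \<and> nbs E MS v = {s0} \<and> k' v < k v \<and> card (nbs E MS s0) + 1 < k s0"
    proof (cases "p > 0 \<and> v = v0 \<and> k' v \<noteq> 0")
      case True
      then have eq: "nbs E MS v = {s0}"
        using v nb0 MF(1) by (auto simp: nbs_def)
      then have "s0 \<in> MS" by (auto simp: nbs_def)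
      moreover have "k' v = k v - 1" using True v s0 by (auto simp: k'_def)
      then have "k' v < k v" using True by linarith
      ultimately show ?thesis using True slack eq by auto
    next
      case False
      moreover have "k' v = 0" if "\<not> (p > 0 \<and> v = v0)"
        using that v(2) unfolding k'_def by presburger
      ultimately show ?thesis by blast
    qed
  qed
  then show False using uncol SR(2) by simp
qed

section \<open>Vertex-critical instances: induction and discharging\<close>

lemma critical_pot:
  fixes E :: "'a set set"
  assumes D: "D \<ge> 2" and "two_sets E" and "finite V" and "\<And>v. v \<in> V \<Longrightarrow> k v \<le> D + 1"
    and "\<not> cap_colorable E V k" and "\<And>T. T \<subset> V \<Longrightarrow> cap_colorable E T k"
  shows "pot D E k V \<le> -3"
  using assms(2-)
proof (induction "card V" arbitrary: E V k rule: less_induct)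
  case less
  note E = less.prems(1) and fin = less.prems(2) and k = less.prems(3)
    and uncol = less.prems(4) and crit = less.prems(5)
  have smaller: "cap_colorable E' W k'"
    if W: "two_sets E'" "finite W" "card W < card V" "\<And>v. v \<in> W \<Longrightarrow> k' v \<le> D + 1"
      and pot: "\<And>T. T \<subseteq> W \<Longrightarrow> T \<noteq> {} \<Longrightarrow> pot D E' k' T \<ge> -2" for E' :: "'a set set" and W k'
  proof -
    \<comment> \<open>A smallest uncolourable subset would be vertex-critical, so the induction
      hypothesis would give it potential at most -3.\<close>
    have "cap_colorable E' T k'" if "T \<subseteq> W" for T
      using finite_subset[OF that W(2)] that
    proof (induction T rule: finite_psubset_induct)
      case (psubset T)
      show ?case
      proof (rule ccontr)
        assume unc: "\<not> cap_colorable E' T k'"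
        have "card T < card V" using card_mono[OF W(2) psubset(3)] W(3) by simp
        then have "pot D E' k' T \<le> -3"
          using unc psubset W(1,4) by (intro less.hyps) auto
        moreover have "T \<noteq> {}" using unc by auto
        ultimately show False using pot[OF psubset(3)] by simp
      qed
    qed
    then show ?thesis by simp
  qed
  show ?case
  proof (rule ccontr)
    assume "\<not> pot D E k V \<le> -3"
    then have potV: "pot D E k V \<ge> -2" by simp
    have gap: "pot D E k T \<ge> 4" if "T \<subset> V" "T \<noteq> {}" for T
      by (rule pot_gap[OF D E fin k smaller uncol crit potV that])
    have charge: "2 * (3 * int D + 2 + 3 * int (k v)) - 3 * (int D + 1) * int (card (nbs E V v)) \<le> -2"
      if v: "v \<in> V" for v
    proof -
      define W where "W = V - {v}"
      define d where "d = card (nbs E V v)"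
      have W: "v \<notin> W" "V = insert v W" "finite W" "W \<subset> V" using v fin by (auto simp: W_def)
      have d: "card (nbs E W v) = d" using nbs_self[OF E, of v W] by (simp add: d_def W(2))
      have d2: "d \<ge> 2"
      proof (rule ccontr)
        assume "\<not> d \<ge> 2"
        moreover obtain M F where MF: "cap_coloring E W k M F"
          using crit[OF W(4)] by (auto simp: cap_colorable_def)
        moreover have "card (nbs E F v) \<le> card (nbs E W v)"
          using MF W(3) by (intro card_nbs_mono) (auto simp: cap_coloring_def)
        ultimately show False
          using cap_colorable_insert_F[OF E W(3,1) MF] d uncol W(2) by simp
      qed
      have dk: "d > 2" if "k v > 0"
        using cap_colorable_insert_small[OF E W(3,1) that crit[OF W(4)]] d uncol W(2)
        by (metis not_le)
      have dk': "d > 3" if k2: "k v \<ge> 2"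
      proof (rule ccontr)
        assume "\<not> d > 3"
        then have d3: "d = 3" using dk k2 by simp
        \<comment> \<open>A colouring for these capacities leaves a spare unit at every neighbour of
          \<open>v\<close> in M, so \<open>v\<close> itself may join M.\<close>
        define k1 where "k1 u = (if {u, v} \<in> E then k u - 1 else k u)" for u
        have le: "k1 u \<le> k u" for u by (simp add: k1_def)
        have "cap_colorable E W k1"
        proof (rule smaller[OF E W(3)])
          show "card W < card V" using psubset_card_mono[OF fin W(4)] .
          show "k1 u \<le> D + 1" if "u \<in> W" for u using le[of u] k[of u] that W(2) by auto
          fix T assume T: "T \<subseteq> W" "T \<noteq> {}"
          have finT: "finite T" and vT: "v \<notin> T" "T \<subset> V" using T W finite_subset by auto
          let ?n = "card (nbs E T v)"
          have "(\<Sum>u\<in>T. if {u, v} \<in> E then 1 else 0) = int (card (T \<inter> {u. {u, v} \<in> E}))"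
            using finT by (simp add: sum.If_cases)
          also have "T \<inter> {u. {u, v} \<in> E} = nbs E T v" by (auto simp: nbs_def)
          finally have "pot D E k T \<le> pot D E k1 T + 3 * int ?n"
            using pot_le_add[of T k k1 "\<lambda>u. if {u, v} \<in> E then 1 else 0" D E]
            by (force simp: k1_def)
          moreover have "?n \<le> 3" using card_nbs_mono[OF W(3) T(1), of E v] d d3 by simp
          moreover have "pot D E k T \<ge> 4" by (rule gap[OF vT(2) T(2)])
          \<comment> \<open>With at most two neighbours in \<open>T\<close> the loss is 6 and the
            gap 4 suffices. With three the loss is 9, but adding \<open>v\<close> lowers the
            potential by at least 9(D + 1) - (6D + 5) = 3D + 4 and still leaves at least -2, so
            \<open>T\<close> had at least 3D + 2.\<close>
          moreover have "pot D E k T \<ge> 8" if n3: "?n = 3"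
          proof -
            have "pot D E k (insert v T) \<ge> -2"
            proof (cases "T = W")
              case False
              then have "insert v T \<subset> V"
                using T(1) W(1,2) vT(1) insert_ident[of v T W] by auto
              then show ?thesis using gap[of "insert v T"] by simp
            qed (use potV W(2) in simp)
            moreover have "int (k v) \<le> int D + 1" using k[OF v] by simp
            ultimately show ?thesis
              using pot_insert[OF E finT vT(1), of D k] n3 D by simp
          qed
          ultimately show "pot D E k1 T \<ge> -2" by (cases "?n = 3") auto
        qed
        then obtain M F where MF: "cap_coloring E W k1 M F" by (auto simp: cap_colorable_def)
        then have MFk: "cap_coloring E W k M F" using cap_coloring_mono le by blast
        have fv: "finite M" "finite F" "M \<inter> F = {}" "W = M \<union> F"
          using MF W(3) by (auto simp: cap_coloring_def)
        have sum: "card (nbs E M v) + card (nbs E F v) = 3"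
          using card_nbs_Un[OF fv(1,2,3), of E v] fv(4) d d3 by simp
        have "cap_colorable E (insert v W) k"
        proof (cases "card (nbs E F v) \<le> 1")
          case True
          then show ?thesis by (rule cap_colorable_insert_F[OF E W(3,1) MFk])
        next
          \<comment> \<open>Two of the three neighbours lie in F, so at most one lies in M, which
            capacity at least 2 allows.\<close>
          case False
          show ?thesis
          proof (rule cap_colorable_insert_M[OF E W(3,1) MFk])
            fix u assume u: "u \<in> nbs E M v"
            then have "card (nbs E M u) < k1 u" "k1 u = k u - 1"
              using MF by (auto simp: cap_coloring_def nbs_def k1_def)
            then show "card (nbs E M u) + 1 < k u" by simp
          qed (use False sum k2 in auto)
        qed
        then show False using uncol W(2) by simp
      qed
      have mult: "3 * (int D + 1) * int d \<ge> 3 * (int D + 1) * m" if "int d \<ge> m" for m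
        using that by (intro mult_left_mono) auto
      have kD: "int (k v) \<le> int D + 1" using k[OF v] by simp
      \<comment> \<open>The degree is at least 2, 3, 4 respectively. The doubled charge is at most
        -2, 1 - 3D and -2; the last bound uses that the capacity is at most D + 1.\<close>
      consider "k v = 0" | "k v = 1" | "k v \<ge> 2" by linarith
      then have "2 * (3 * int D + 2 + 3 * int (k v)) - 3 * (int D + 1) * int d \<le> -2"
      proof cases
        case 1
        then show ?thesis using mult[of 2] d2 by simp
      next
        case 2
        then show ?thesis using mult[of 3] dk D by simp
      next
        case 3
        then show ?thesis using mult[of 4] dk' kD by simp
      qed
      then show ?thesis by (simp add: d_def)
    qed
    have "2 * pot D E k V = (\<Sum>v\<in>V. 2 * (3 * int D + 2 + 3 * int (k v)))
        - 3 * (int D + 1) * int (\<Sum>v\<in>V. card (nbs E V v))"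
      unfolding sum_card_nbs[OF E fin] pot_def
      by (simp add: sum_distrib_left algebra_simps)
    also have "\<dots> = (\<Sum>v\<in>V. 2 * (3 * int D + 2 + 3 * int (k v))
        - 3 * (int D + 1) * int (card (nbs E V v)))"
      by (simp only: sum_subtractf of_nat_sum sum_distrib_left)
    also have "\<dots> \<le> (\<Sum>v\<in>V. -2)" using charge by (intro sum_mono)
    finally have "pot D E k V \<le> - int (card V)" by simp
    \<comment> \<open>A vertex of degree at most 1 would have positive charge. Hence some vertex has
      two neighbours, and the bound by \<open>- int (card V)\<close> reaches -3.\<close>
    moreover have "card V \<ge> 3"
    proof -
      obtain v where v: "v \<in> V" using uncol by fastforce
      have "card (nbs E V v) \<ge> 2"
      proof (rule ccontr)
        assume "\<not> card (nbs E V v) \<ge> 2"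
        then have "card (nbs E V v) = 0 \<or> card (nbs E V v) = 1" by linarith
        then show False using charge[OF v] by auto
      qed
      moreover have "insert v (nbs E V v) \<subseteq> V" "v \<notin> nbs E V v"
        using v E by (auto simp: nbs_def two_sets_def)
      ultimately show ?thesis
        using card_mono[OF fin, of "insert v (nbs E V v)"] fin by simp
    qed
    ultimately show False using potV by simp
  qed
qed

section \<open>Back to graphs and their critical subgraphs\<close>

lemma simple_graph_two_sets: "simple_graph G \<Longrightarrow> two_sets (edges G)"
  by (fastforce simp: simple_graph_def two_sets_def card_2_iff)

lemma induced_degree:
  assumes E: "two_sets (edges G)" and v: "v \<in> M"
  shows "degree (induced_subgraph G M) v = card (nbs (edges G) M v)"
proof -
  have "{e \<in> edges (induced_subgraph G M). v \<in> e} = (\<lambda>u. {u, v}) ` nbs (edges G) M v"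
  proof (intro equalityI subsetI)
    fix e assume e: "e \<in> {e \<in> edges (induced_subgraph G M). v \<in> e}"
    then have eM: "e \<in> edges G" "e \<subseteq> M" "v \<in> e" by (auto simp: induced_subgraph_def)
    then obtain a b where "e = {a, b}" using E by (auto simp: two_sets_def card_2_iff)
    then obtain u where "e = {u, v}" using eM(3) by (auto simp: insert_commute)
    then show "e \<in> (\<lambda>u. {u, v}) ` nbs (edges G) M v" using eM by (auto simp: nbs_def)
  qed (use v in \<open>auto simp: induced_subgraph_def nbs_def\<close>)
  moreover have "inj_on (\<lambda>u. {u, v}) (nbs (edges G) M v)"
    by (auto simp: inj_on_def doubleton_eq_iff)
  ultimately show ?thesis by (simp add: degree_def card_image)
qed

text \<open>Nested induced subgraphs collapse, \<open>forest\<close> becomes \<open>acyc\<close>,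
  and degree at most D reads as fewer than D + 1 neighbours.\<close>

lemma DF_colorable_induced:
  assumes G: "simple_graph G" and T: "T \<subseteq> verts G"
  shows "DF_colorable D (induced_subgraph G T) \<longleftrightarrow> cap_colorable (edges G) T (\<lambda>_. D + 1)"
proof -
  note E = simple_graph_two_sets[OF G]
  have fin: "finite T" using G T finite_subset by (auto simp: simple_graph_def)
  have ind: "induced_subgraph (induced_subgraph G T) X = induced_subgraph G X" if "X \<subseteq> T" for X
    using that by (auto simp: induced_subgraph_def)
  have "DF_coloring D (induced_subgraph G T) M F \<longleftrightarrow> cap_coloring (edges G) T (\<lambda>_. D + 1) M F"
    for M F
  proof (cases "M \<union> F = T")
    case True
    then have sub: "M \<subseteq> T" "F \<subseteq> T" "finite M" "finite F" using fin by auto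
    show ?thesis
      unfolding DF_coloring_def cap_coloring_def ind[OF sub(1)] ind[OF sub(2)]
        forest_iff_acyc[OF E sub(3)] forest_iff_acyc[OF E sub(4)]
      using induced_degree[OF E, of _ M] True
      by (auto simp: induced_subgraph_def less_Suc_eq_le)
  qed (auto simp: DF_coloring_def cap_coloring_def induced_subgraph_def)
  then show ?thesis by (simp add: DF_colorable_def cap_colorable_def)
qed

theorem theorem1p5:
  fixes D :: nat and G :: "'a graph"
  assumes "D \<ge> 2"
    and "simple_graph G"
    and "DF_critical D G"
    and "card (verts G) \<ge> 3"
  shows "real (card (edges G)) \<ge>
    ((6 * real D + 5) * real (card (verts G)) + 3) / (3 * (real D + 1))"
proof -
  let ?k = "\<lambda>_ :: 'a. D + 1"
  have fin: "finite (verts G)" and sub: "\<And>e. e \<in> edges G \<Longrightarrow> e \<subseteq> verts G"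
    using assms(2) by (auto simp: simple_graph_def)
  have G_eq: "induced_subgraph G (verts G) = G"
    using sub by (auto simp: induced_subgraph_def intro!: graph.equality)
  have uncol: "\<not> cap_colorable (edges G) (verts G) ?k"
    using DF_colorable_induced[OF assms(2) subset_refl, of D] assms(3) G_eq
    by (simp add: DF_critical_def)
  have crit: "cap_colorable (edges G) T ?k" if T: "T \<subset> verts G" for T
  proof -
    have "simple_graph (induced_subgraph G T)"
      unfolding simple_graph_def
    proof (intro conjI subsetI)
      show "finite (verts (induced_subgraph G T))"
        using T fin finite_subset by (auto simp: induced_subgraph_def)
      fix e assume e: "e \<in> edges (induced_subgraph G T)"
      then obtain u v where "e = {u, v}" "u \<noteq> v"
        using assms(2) by (auto simp: simple_graph_def induced_subgraph_def)
      then show "e \<in> {{u, v} |u v. u \<in> verts (induced_subgraph G T) \<and>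
          v \<in> verts (induced_subgraph G T) \<and> u \<noteq> v}"
        using e by (auto simp: induced_subgraph_def)
    qed
    moreover have "verts (induced_subgraph G T) \<noteq> verts G"
      using T by (auto simp: induced_subgraph_def)
    then have "induced_subgraph G T \<noteq> G" by metis
    ultimately have "proper_subgraph (induced_subgraph G T) G"
      using T by (simp add: proper_subgraph_def subgraph_def) (auto simp: induced_subgraph_def)
    then show ?thesis
      using DF_colorable_induced[OF assms(2), of T D] assms(3) T by (auto simp: DF_critical_def)
  qed
  have "{e \<in> edges G. e \<subseteq> verts G} = edges G" using sub by auto
  moreover have "pot D (edges G) ?k (verts G) \<le> -3"
  proof (rule critical_pot[OF assms(1) simple_graph_two_sets[OF assms(2)] fin])
    show "cap_colorable (edges G) T ?k" if "T \<subset> verts G" for T by (rule crit[OF that])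
  qed (use uncol in simp_all)
  ultimately
  \<comment> \<open>At constant capacity D + 1 every vertex weighs (3D + 2) + 3(D + 1) = 6D +
    5.\<close>
  have "int (card (verts G)) * (6 * int D + 5) - 3 * (int D + 1) * int (card (edges G)) \<le> -3"
    by (simp add: pot_def ecount_def algebra_simps)
  then have "int ((6 * D + 5) * card (verts G) + 3) \<le> int (3 * (D + 1) * card (edges G))"
    by (simp add: algebra_simps)
  then have "real ((6 * D + 5) * card (verts G) + 3) \<le> real (3 * (D + 1) * card (edges G))"
    by (simp only: of_nat_le_iff)
  then show ?thesis
    by (simp add: field_simps)
qed

end
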